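(* Let $K$ be a field of characteristic $0$, let $\alpha \in K$, and let $n$ be a positive integer. If $f(t) \in K[t]$ is a factor of $t^n - \alpha$ over $K$, then $\lambda_K(\alpha, n)$ divides $\deg f(t)$.
   Context: For a field $K$, an element $\alpha \in K$ and a positive integer $n$, $\lambda_K(\alpha,n)$ denotes the minimal degree of an irreducible factor of $t^n - \alpha$ in $K[t]$. *)

theory Defs
  imports "HOL-Computational_Algebra.Polynomial_Factorial"
begin

definition lambdaK :: "'a::field \<Rightarrow> nat \<Rightarrow> nat" where
  "lambdaK \<alpha> n = (LEAST d. \<exists>g :: 'a poly. irreducible g \<and> g dvd (monom 1 n - [:\<alpha>:]) \<and> degree g = d)"

end

theory Submission
  imports
    "HOL-Algebra.Algebraic_Closure_Type"
    "Jordan_Normal_Form.Char_Poly"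
    Defs
begin

text \<open>
  It suffices that some degree \<open>d\<close> of an irreducible factor of \<open>t^n - a\<close> divides all the others.

  For \<open>n = p^k\<close> with a primitive \<open>p\<close>-th root of unity in \<open>K\<close>: if \<open>h\<close> is an irreducible factor of
  \<open>t^(p^(k-1)) - a\<close> of degree \<open>m\<close>, then the irreducible factors of \<open>h(t^p)\<close> have degree \<open>m\<close> or
  \<open>p m\<close>. Hence all the degrees are powers of \<open>p\<close>, and the least one divides the others.

  For \<open>n = p^k\<close> without such a root of unity: write \<open>a = b^(p^j)\<close> with \<open>j \<le> k\<close> maximal. The constant
  term of a factor of degree \<open>m\<close> gives a \<open>c\<close> in \<open>K\<close> with \<open>c^(p^k) = a^m\<close>, and since extraction of
  \<open>p\<close>-th roots in \<open>K\<close> is unique, maximality of \<open>j\<close> forces \<open>p^(k-j)\<close> to divide \<open>m\<close>. An irreducible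
  factor of \<open>t^(p^(k-j)) - b\<close> attains this degree.

  For coprime \<open>m\<close> and \<open>n\<close>, the roots \<open>x\<close> of \<open>t^(m n) - a\<close> correspond to the pairs \<open>(x^n, x^m)\<close> of
  roots of \<open>t^m - a\<close> and \<open>t^n - a\<close>, so that the minimal degrees multiply.
\<close>

hide_const (open) up_ring.monom up_ring.coeff Divisibility.irreducible Coset.order

section \<open>Roots in the algebraic closure and irreducible factors\<close>

interpretation to_ac: field_hom "to_ac :: 'a::field \<Rightarrow> 'a alg_closure"
  by unfold_locales auto

interpretation map_poly_to_ac: map_poly_inj_idom_hom "to_ac :: 'a::field \<Rightarrow> 'a alg_closure"
  by unfold_locales

text \<open>A plain set, so multiplicities are lost and cardinalities count distinct roots.\<close>

definition ac_roots :: "'a::field poly \<Rightarrow> 'a alg_closure set" where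
  "ac_roots p = {x. poly (map_poly to_ac p) x = 0}"

lemma ac_roots_dvd: "g dvd h \<Longrightarrow> ac_roots g \<subseteq> ac_roots h"
  by (auto simp: ac_roots_def dvd_def hom_distribs)

lemma ac_roots_mult: "ac_roots (p * q) = ac_roots p \<union> ac_roots q"
  by (auto simp: ac_roots_def hom_distribs)

lemma ac_roots_pcompose:
  "x \<in> ac_roots (pcompose p q) \<longleftrightarrow> poly (map_poly to_ac q) x \<in> ac_roots p"
  by (auto simp: ac_roots_def to_ac.map_poly_pcompose poly_pcompose)

lemma ac_roots_pcompose_monom:
  "x \<in> ac_roots (pcompose p (monom 1 k)) \<longleftrightarrow> x ^ k \<in> ac_roots p"
  by (simp add: ac_roots_pcompose poly_monom)

lemma finite_ac_roots: "p \<noteq> 0 \<Longrightarrow> finite (ac_roots p)"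
  unfolding ac_roots_def by (rule poly_roots_finite) auto

lemma card_ac_roots_le: "p \<noteq> 0 \<Longrightarrow> card (ac_roots p) \<le> degree p"
  unfolding ac_roots_def
  using card_poly_roots_bound[of "map_poly to_ac p"] by auto

lemma ac_roots_nonempty:
  assumes "degree p > 0"
  obtains x where "x \<in> ac_roots p"
  using alg_closed_imp_poly_has_root[of "map_poly to_ac p"] assms
  by (auto simp: ac_roots_def)

lemma irreducible_field_poly_degree_pos:
  fixes g :: "'a::field poly"
  assumes "irreducible g"
  shows "degree g > 0"
  using assms irreducible\<^sub>dD(1)[of g] by simp

text \<open>A nonzero polynomial \<open>r\<close> of least degree vanishing at \<open>x\<close>
  divides every polynomial vanishing at \<open>x\<close>. In particular it divides \<open>g\<close>,
  and being no unit it is associated to \<open>g\<close>.\<close>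

lemma irreducible_dvd_if_common_root:
  assumes g: "irreducible g" and xg: "x \<in> ac_roots g" and xh: "x \<in> ac_roots h"
  shows "g dvd h"
proof -
  obtain r where r: "r \<noteq> 0" "x \<in> ac_roots r"
    and min: "\<And>s. s \<noteq> 0 \<Longrightarrow> x \<in> ac_roots s \<Longrightarrow> degree r \<le> degree s"
    using ex_has_least_nat[of "\<lambda>r. r \<noteq> 0 \<and> x \<in> ac_roots r" g degree]
      irreducible_field_poly_degree_pos[OF g] xg by fastforce
  have dvd: "r dvd s" if "x \<in> ac_roots s" for s
  proof (rule ccontr)
    assume "\<not> r dvd s"
    then have "s mod r \<noteq> 0" by (simp add: mod_eq_0_iff_dvd)
    moreover have "x \<in> ac_roots (s mod r)"
      using r that by (auto simp: ac_roots_def to_ac.map_poly_mod poly_mod)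
    ultimately show False
      using min[of "s mod r"] degree_mod_less[of r s] r by auto
  qed
  have "degree r > 0"
    using r by (auto simp: ac_roots_def elim!: degree_eq_zeroE intro!: gr0I)
  then have "\<not> is_unit r"
    by (auto simp: is_unit_iff_degree)
  then have "g dvd r"
    using irreducibleD'[OF g dvd[OF xg]] by blast
  from this dvd[OF xh] show ?thesis by (rule dvd_trans)
qed

lemma irreducible_factor_with_root:
  assumes "p \<noteq> 0" "x \<in> ac_roots p"
  obtains g where "irreducible g" "g dvd p" "x \<in> ac_roots g"
proof -
  have "\<exists>g. irreducible g \<and> g dvd p \<and> x \<in> ac_roots g"
    using assms
  proof (induction "degree p" arbitrary: p rule: less_induct)
    case less
    have "degree p > 0"
      using less.prems by (auto simp: ac_roots_def elim!: degree_eq_zeroE intro!: gr0I)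
    then obtain q r where q: "irreducible q" and p: "p = q * r"
      using irreducible_monic_factor by blast
    show ?case
    proof (cases "x \<in> ac_roots q")
      case True
      then show ?thesis using q p by auto
    next
      case False
      then have "x \<in> ac_roots r" using less.prems by (simp add: p ac_roots_mult)
      moreover have "r \<noteq> 0" using less.prems p by auto
      moreover have "degree r < degree p"
        using irreducible_field_poly_degree_pos[OF q] less.prems(1) p
          degree_mult_eq[of q r] by auto
      ultimately obtain g where "irreducible g" "g dvd r" "x \<in> ac_roots g"
        using less.hyps[of r] by blast
      then show ?thesis using p dvd_mult by blast
    qed
  qed
  then show ?thesis using that by blast
qed

text \<open>Degrees add up along a factorization into irreducibles. This reduces the theorem to
  irreducible factors.\<close>

lemma dvd_degree_if_dvd_irreducible_factors:
  fixes f :: "'a::field poly"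
  assumes "f \<noteq> 0" "\<And>g. irreducible g \<Longrightarrow> g dvd f \<Longrightarrow> d dvd degree g"
  shows "d dvd degree f"
  using assms
proof (induction "degree f" arbitrary: f rule: less_induct)
  case less
  show ?case
  proof (cases "degree f = 0")
    case False
    then obtain q r where q: "irreducible q" and f: "f = q * r"
      using irreducible_monic_factor by blast
    have "r \<noteq> 0" "q \<noteq> 0" using less.prems f by auto
    then have deg: "degree f = degree q + degree r"
      using degree_mult_eq f by blast
    have "degree r < degree f"
      using irreducible_field_poly_degree_pos[OF q] deg by simp
    moreover have "d dvd degree g" if "irreducible g" "g dvd r" for g
      using less.prems(2)[OF that(1)] that(2) f dvd_mult by blast
    ultimately have "d dvd degree r"
      using less.hyps[OF _ \<open>r \<noteq> 0\<close>] by blast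
    moreover have "d dvd degree q"
      using less.prems(2)[OF q] f dvd_triv_left by blast
    ultimately show ?thesis by (simp add: deg)
  qed simp
qed

lemma dvd_smult_if_dvd_same_degree:
  fixes p q :: "'a::field poly"
  assumes "p dvd q" "degree p = degree q" "q \<noteq> 0"
  obtains c where "q = smult c p"
proof -
  from assms obtain r where q: "q = p * r" by auto
  with assms have "degree r = 0" by (auto simp: degree_mult_eq)
  then show ?thesis using that q by (auto elim!: degree_eq_zeroE)
qed

section \<open>Factors of t^n - a\<close>

lemma ac_roots_binomial: "x \<in> ac_roots (monom 1 n - [:a:]) \<longleftrightarrow> x ^ n = to_ac a"
  by (simp add: ac_roots_def hom_distribs poly_monom)

lemma degree_binomial:
  fixes a :: "'a::field"
  assumes "n > 0"
  shows "degree (monom 1 n - [:a:]) = n"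
proof -
  have "degree (monom 1 n + (- [:a:])) = n"
    using assms by (subst degree_add_eq_left) (auto simp: degree_monom_eq)
  then show ?thesis by (simp only: diff_conv_add_uminus)
qed

lemma binomial_nonzero:
  fixes a :: "'a::field"
  assumes "n > 0"
  shows "monom 1 n - [:a:] \<noteq> 0"
  using degree_binomial[OF assms, of a] assms by auto

lemma factorization_ac:
  fixes g :: "'a::field poly"
  assumes "g \<noteq> 0"
  obtains A where "size A = degree g" "ac_roots g = set_mset A"
    "map_poly to_ac g = smult (to_ac (lead_coeff g)) (\<Prod>x\<in>#A. [:- x, 1:])"
proof -
  obtain A where A: "size A = degree g"
    "map_poly to_ac g = smult (to_ac (lead_coeff g)) (\<Prod>x\<in>#A. [:- x, 1:])"
    using alg_closed_imp_factorization[of "map_poly to_ac g"] assms by auto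
  have "ac_roots g = set_mset A"
    using assms by (auto simp: ac_roots_def A(2) poly_prod_mset)
  with A that show ?thesis by blast
qed

text \<open>All roots of t^n - a are simple, and a repeated root of \<open>g\<close> would be a
  repeated root of t^n - a.\<close>

lemma card_ac_roots_binomial_factor:
  fixes a :: "'a::field_char_0"
  assumes n: "n > 0" and a: "a \<noteq> 0" and g: "g dvd monom 1 n - [:a:]"
  shows "card (ac_roots g) = degree g"
proof -
  let ?T = "map_poly to_ac (monom 1 n - [:a:])"
  have "g \<noteq> 0" using g binomial_nonzero[OF n, of a] by auto
  then obtain A where A: "size A = degree g" "ac_roots g = set_mset A"
    "map_poly to_ac g = smult (to_ac (lead_coeff g)) (\<Prod>x\<in>#A. [:- x, 1:])"
    by (rule factorization_ac)
  \<comment> \<open>In characteristic 0 the derivative n t^(n-1) can vanish only at 0, which is no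
    root since \<open>a \<noteq> 0\<close>.\<close>
  have "rsquarefree ?T"
    using n a by (auto simp: rsquarefree_roots hom_distribs pderiv_diff pderiv_monom poly_monom
        pderiv_pCons power_0_left)
  have "count A x \<le> 1" for x
  proof (rule ccontr)
    assume "\<not> count A x \<le> 1"
    then have "{#x, x#} \<subseteq># A"
      by (auto simp: subseteq_mset_def)
    then obtain B where B: "A = {#x, x#} + B" by (auto simp: subset_mset.le_iff_add)
    have "map_poly to_ac g =
        smult (to_ac (lead_coeff g)) ([:- x, 1:] ^ 2 * (\<Prod>x\<in>#B. [:- x, 1:]))"
      by (simp add: A(3) B power2_eq_square mult.assoc del: mult_pCons_left mult_pCons_right)
    then have "[:- x, 1:] ^ 2 dvd map_poly to_ac g"
      by (metis dvd_smult dvd_triv_left)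
    also have "\<dots> dvd ?T"
      using g by (rule map_poly_to_ac.hom_dvd)
    finally have "2 \<le> order x ?T"
      using order_divides binomial_nonzero[OF n, of a] by (metis map_poly_to_ac.hom_0_iff)
    moreover have "order x ?T = 0 \<or> order x ?T = 1"
      using \<open>rsquarefree ?T\<close> by (auto simp: rsquarefree_def)
    ultimately show False by auto
  qed
  then have "A = mset_set (set_mset A)"
    by (intro multiset_eqI) (metis count_greater_zero_iff count_mset_set(1,3) finite_set_mset
        le_antisym less_one not_less not_in_iff)
  then show ?thesis using A by (metis size_mset_set)
qed

text \<open>The product of the roots of \<open>g\<close>, taken with multiplicity, lies in K, and
  the n-th power of each root is \<open>a\<close>.\<close>

lemma power_constant_term_binomial_factor:
  fixes a :: "'a::field"
  assumes n: "n > 0" and g: "g dvd monom 1 n - [:a:]"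
  obtains c where "c ^ n = a ^ degree g"
proof -
  have "g \<noteq> 0" using g binomial_nonzero[OF n, of a] by auto
  then obtain A where A: "size A = degree g" "ac_roots g = set_mset A"
    "map_poly to_ac g = smult (to_ac (lead_coeff g)) (\<Prod>x\<in>#A. [:- x, 1:])"
    by (rule factorization_ac)
  \<comment> \<open>By Vieta this is the product of the roots of \<open>g\<close>.\<close>
  define c where "c = (-1) ^ degree g * poly g 0 / lead_coeff g"
  have "to_ac (poly g 0) = poly (map_poly to_ac g) (to_ac 0)"
    using to_ac.poly_map_poly[of g 0] by simp
  also have "\<dots> = to_ac (lead_coeff g) * (\<Prod>x\<in>#A. - x)"
    by (simp add: A(3) poly_prod_mset)
  also have "(\<Prod>x\<in>#A. - x) = (-1) ^ size A * \<Prod>\<^sub># A"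
    by (induction A) auto
  finally have c: "to_ac c = \<Prod>\<^sub># A"
    using \<open>g \<noteq> 0\<close> by (simp add: c_def A(1) flip: power_mult_distrib mult.assoc)
  have "x ^ n = to_ac a" if "x \<in># A" for x
    using that ac_roots_dvd[OF g] A(2) ac_roots_binomial by blast
  then have "(\<Prod>\<^sub># A) ^ n = to_ac a ^ size A"
    by (induction A) (auto simp: power_mult_distrib)
  then have "to_ac (c ^ n) = to_ac (a ^ degree g)"
    by (simp add: c A(1))
  then show ?thesis using that to_ac_eq_iff by blast
qed

section \<open>The tower law for degrees\<close>

text \<open>Without a common root, \<open>p\<close> would be coprime to \<open>q\<close> and would
  divide \<open>r\<close>, which its degree forbids.\<close>

lemma common_root_if_dvd_mult:
  fixes p q r :: "'a::alg_closed_field poly"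
  assumes "p dvd q * r" "degree r < degree p" "r \<noteq> 0"
  obtains x where "poly p x = 0" "poly q x = 0"
proof -
  have "\<exists>x. poly p x = 0 \<and> poly q x = 0"
    using assms
  proof (induction "degree r" arbitrary: p r rule: less_induct)
    case less
    obtain x where x: "poly p x = 0"
      using alg_closed_imp_poly_has_root[of p] less.prems by auto
    then obtain p' where p': "p = [:- x, 1:] * p'"
      by (auto simp: poly_eq_0_iff_dvd)
    show ?case
    proof (cases "poly q x = 0")
      case False
      \<comment> \<open>As \<open>q\<close> does not vanish at \<open>x\<close>, \<open>r\<close>
        must. Cancelling the linear factor from \<open>p\<close> and \<open>r\<close> lowers both
        degrees by one.\<close>
      have "poly (q * r) x = 0"
        using less.prems(1) x by (metis dvdE mult_zero_left poly_mult)
      with False obtain r' where r': "r = [:- x, 1:] * r'"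
        by (auto simp: poly_eq_0_iff_dvd)
      have nz: "r' \<noteq> 0" "p' \<noteq> 0" using less.prems r' p' by auto
      then have deg: "degree r = Suc (degree r')" "degree p = Suc (degree p')"
        by (auto simp: r' p' degree_mult_eq simp del: mult_pCons_left)
      have "[:- x, 1:] * p' dvd [:- x, 1:] * (q * r')"
        using less.prems(1) by (simp only: r' p' mult.left_commute)
      then have "p' dvd q * r'"
        by (subst (asm) dvd_mult_cancel_left) auto
      then obtain y where "poly p' y = 0" "poly q y = 0"
        using less.hyps[of r' p'] deg nz less.prems(2) by auto
      then show ?thesis using p' by auto
    qed (use x in auto)
  qed
  then show ?thesis using that by blast
qed

lemma degree_eq_if_common_root:
  assumes "irreducible g" "irreducible h" "x \<in> ac_roots g" "x \<in> ac_roots h"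
  shows "degree g = degree h"
proof -
  have "g dvd h" "h dvd g"
    using assms irreducible_dvd_if_common_root by blast+
  moreover have "g \<noteq> 0" "h \<noteq> 0"
    using assms irreducible_field_poly_degree_pos by fastforce+
  ultimately show ?thesis by (simp add: dvd_imp_degree_le le_antisym)
qed

text \<open>
  The tower law: the characteristic polynomial of multiplication by \<open>q\<close> on \<open>K[t]/(g)\<close> has degree
  \<open>degree g\<close>, and all its eigenvalues are values of \<open>q\<close> at roots of \<open>g\<close>, hence roots of \<open>h\<close>; so it
  is a power of \<open>h\<close> up to a unit.
\<close>
lemma degree_dvd_degree_if_dvd_pcompose:
  fixes g h q :: "'a::field poly"
  assumes h: "irreducible h" and g: "irreducible g" and dvd: "g dvd pcompose h q"
  shows "degree h dvd degree g"
proof -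
  define m where "m = degree g"
  define A where "A = mat m m (\<lambda>(i, j). coeff ((q * monom 1 j) mod g) i)"
  define B where "B = map_mat to_ac A"
  have A: "A \<in> carrier_mat m m" and B: "B \<in> carrier_mat m m"
    by (simp_all add: A_def B_def)
  have "m > 0" using g irreducible_field_poly_degree_pos by (auto simp: m_def)
  then have "g \<noteq> 0" by (auto simp: m_def)
  have deg: "degree (char_poly A) = m"
    using degree_monic_char_poly[OF A] by simp
  have root: "\<mu> \<in> ac_roots h" if "\<mu> \<in> ac_roots (char_poly A)" for \<mu>
  proof -
    have "eigenvalue B \<mu>"
      using that unfolding eigenvalue_root_char_poly[OF B]
      by (simp add: B_def ac_roots_def to_ac.char_poly_hom[OF A])
    then obtain v where v: "v \<in> carrier_vec m" "v \<noteq> 0\<^sub>v m" "B *\<^sub>v v = \<mu> \<cdot>\<^sub>v v"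
      using B by (auto simp: eigenvalue_def eigenvector_def)
    define G where "G = map_poly to_ac g"
    define Q where "Q = map_poly to_ac q"
    \<comment> \<open>The eigenvector read as a polynomial of degree below \<open>m\<close>: the
      eigenvalue equation says that \<open>Q * V\<close> and \<open>smult \<mu> V\<close> agree
      modulo \<open>G\<close>.\<close>
    define V where "V = (\<Sum>j<m. monom (v $ j) j)"
    have coeff_V: "coeff V i = (if i < m then v $ i else 0)" for i
      by (simp add: V_def coeff_sum)
    obtain j where "j < m" "v $ j \<noteq> 0"
      using v(1,2) by (metis carrier_vecD eq_vecI index_zero_vec)
    then have "V \<noteq> 0" using coeff_V[of j] by auto
    then have "degree V < m"
      using coeff_V[of "degree V"] by (metis leading_coeff_0_iff)
    have "(\<Sum>j<m. smult (v $ j) ((Q * monom 1 j) mod G)) = smult \<mu> V"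
    proof (rule poly_eqI)
      fix i
      have R: "(Q * monom 1 j) mod G = map_poly to_ac ((q * monom 1 j) mod g)" for j
        by (simp add: Q_def G_def hom_distribs)
      show "coeff (\<Sum>j<m. smult (v $ j) ((Q * monom 1 j) mod G)) i = coeff (smult \<mu> V) i"
      proof (cases "i < m")
        case True
        have "coeff (\<Sum>j<m. smult (v $ j) ((Q * monom 1 j) mod G)) i
          = (\<Sum>j<m. v $ j * to_ac (coeff ((q * monom 1 j) mod g) i))"
          by (simp add: R coeff_sum)
        also have "\<dots> = (B *\<^sub>v v) $ i"
          using True v(1) by (auto simp: B_def A_def scalar_prod_def lessThan_atLeast0 mult.commute)
        also have "\<dots> = coeff (smult \<mu> V) i"
          using True v by (simp add: coeff_V)
        finally show ?thesis .
      next
        case False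
        have "coeff ((q * monom 1 j) mod g) i = 0" for j
          using False degree_mod_less[OF \<open>g \<noteq> 0\<close>, of "q * monom 1 j"]
          by (cases "(q * monom 1 j) mod g = 0") (auto simp: m_def intro!: coeff_eq_0)
        with False show ?thesis by (simp add: R coeff_sum coeff_V)
      qed
    qed
    moreover have "Q * V = (\<Sum>j<m. smult (v $ j) (Q * monom 1 j))"
      by (simp add: V_def sum_distrib_left smult_monom flip: mult_smult_right)
    \<comment> \<open>Since \<open>G\<close> divides this product and \<open>V\<close> has smaller
      degree than \<open>G\<close>, some root of \<open>G\<close> is sent to \<open>\<mu>\<close> by
      \<open>Q\<close>.\<close>
    ultimately have "(Q - [:\<mu>:]) * V
      = (\<Sum>j<m. smult (v $ j) (Q * monom 1 j - (Q * monom 1 j) mod G))"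
      by (simp add: left_diff_distrib smult_diff_right sum_subtractf)
    also have "G dvd \<dots>"
      by (intro dvd_sum dvd_smult dvd_minus_mod)
    finally obtain x where x: "poly G x = 0" "poly (Q - [:\<mu>:]) x = 0"
      using common_root_if_dvd_mult \<open>degree V < m\<close> \<open>V \<noteq> 0\<close>
      by (metis G_def m_def to_ac.degree_map_poly_hom)
    then have "x \<in> ac_roots g" "poly Q x = \<mu>"
      by (simp_all add: ac_roots_def G_def)
    then show "\<mu> \<in> ac_roots h"
      using ac_roots_dvd[OF dvd] ac_roots_pcompose unfolding Q_def by blast
  qed
  \<comment> \<open>Each irreducible factor of the characteristic polynomial shares a root with
    \<open>h\<close>, hence has the degree of \<open>h\<close>.\<close>
  have "degree h dvd degree (char_poly A)"
  proof (rule dvd_degree_if_dvd_irreducible_factors)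
    show "char_poly A \<noteq> 0" using deg \<open>m > 0\<close> by auto
    fix s assume s: "irreducible s" "s dvd char_poly A"
    then obtain \<mu> where "\<mu> \<in> ac_roots s"
      using ac_roots_nonempty irreducible_field_poly_degree_pos by blast
    then show "degree h dvd degree s"
      using degree_eq_if_common_root[OF s(1) h] root ac_roots_dvd[OF s(2)] by auto
  qed
  then show ?thesis by (simp add: deg m_def)
qed

section \<open>Roots of unity of prime order\<close>

lemma eq_one_if_coprime_powers_eq_one:
  fixes z :: "'a::field"
  assumes "z ^ a = 1" "z ^ b = 1" "coprime a b"
  shows "z = 1"
proof (cases "a = 0")
  case True
  then show ?thesis using assms by simp
next
  case False
  then obtain x y where xy: "a * x = b * y + 1"
    using bezout_nat[of a b] assms(3) by auto
  have "z ^ (a * x) = z ^ (b * y) * z"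
    by (simp only: xy power_add power_one_right)
  then show ?thesis
    by (simp only: power_mult assms(1,2) power_one mult_1_left)
qed

lemma prime_dvd_if_power_eq_one:
  fixes z :: "'a::field"
  assumes "prime p" "z ^ p = 1" "z \<noteq> 1" "z ^ i = 1"
  shows "p dvd i"
  using assms eq_one_if_coprime_powers_eq_one prime_imp_coprime by blast

text \<open>The powers of \<open>\<zeta>\<close> with exponent below \<open>p\<close> are distinct,
  so they exhaust the at most \<open>p\<close> roots of t^p - 1 in the closure.\<close>

lemma root_of_unity_in_base_field:
  fixes \<zeta> :: "'a::field" and \<xi> :: "'a alg_closure"
  assumes p: "prime p" and \<zeta>: "\<zeta> ^ p = 1" "\<zeta> \<noteq> 1" and \<xi>: "\<xi> ^ p = 1"
  obtains \<omega> where "\<xi> = to_ac \<omega>"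
proof -
  have "p > 0" using p prime_gt_0_nat by blast
  define S where "S = (\<lambda>i. to_ac (\<zeta> ^ i)) ` {..<p}"
  have aux: "i = j" if "\<zeta> ^ i = \<zeta> ^ j" "i \<le> j" "j < p" for i j
  proof -
    have "\<zeta> ^ i * \<zeta> ^ (j - i) = \<zeta> ^ i * 1"
      using that by (metis le_add_diff_inverse mult.right_neutral power_add)
    moreover have "\<zeta> \<noteq> 0"
      using \<zeta>(1) \<open>p > 0\<close> zero_power zero_neq_one by metis
    ultimately have "p dvd j - i"
      using prime_dvd_if_power_eq_one[OF p \<zeta>] by simp
    then show ?thesis using that by (auto dest: dvd_imp_le)
  qed
  have "inj_on (\<lambda>i. to_ac (\<zeta> ^ i)) {..<p}"
  proof (rule inj_onI)
    fix i j assume ij: "i \<in> {..<p}" "j \<in> {..<p}" "to_ac (\<zeta> ^ i) = to_ac (\<zeta> ^ j)"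
    then have eq: "\<zeta> ^ i = \<zeta> ^ j" using to_ac_eq_iff by blast
    show "i = j"
    proof (cases "i \<le> j")
      case True
      with eq ij(2) show ?thesis by (intro aux) simp_all
    next
      case False
      with eq ij(1) show ?thesis by (intro aux[symmetric]) simp_all
    qed
  qed
  then have "card S = p" by (simp add: S_def card_image)
  let ?R = "ac_roots (monom 1 p - [:1:] :: 'a poly)"
  have "to_ac (\<zeta> ^ i) ^ p = to_ac 1" for i
    by (metis \<zeta>(1) mult.commute power_mult power_one to_ac_power)
  then have "S \<subseteq> ?R"
    by (auto simp: S_def ac_roots_binomial simp del: to_ac_power)
  moreover have "card ?R \<le> p" "finite ?R"
    using card_ac_roots_le finite_ac_roots degree_binomial binomial_nonzero \<open>p > 0\<close> by metis+
  ultimately have "S = ?R"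
    using \<open>card S = p\<close> by (intro card_seteq) auto
  moreover have "\<xi> \<in> ?R" using \<xi> by (simp add: ac_roots_binomial)
  ultimately have "\<xi> \<in> S" by blast
  then show ?thesis using that unfolding S_def by blast
qed

section \<open>Prime power exponents, with a root of unity in K\<close>

lemma poly_in_power_if_coeffs:
  fixes g :: "'a::field poly"
  assumes "p > 0" "\<And>i. coeff g i \<noteq> 0 \<Longrightarrow> p dvd i"
  obtains H where "g = pcompose H (monom 1 p)"
proof -
  define H where "H = (\<Sum>i\<le>degree g. monom (coeff g (p * i)) i)"
  have comp: "pcompose (monom c i) (monom 1 p) = monom c (p * i)" for c :: 'a and i
    by (simp add: monom_altdef pcompose_smult pcompose_hom.hom_power pcompose_pCons power_mult)
  have "pcompose H (monom 1 p) = (\<Sum>i\<le>degree g. monom (coeff g (p * i)) (p * i))"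
    by (simp add: H_def pcompose_sum comp)
  also have "\<dots> = g"
  proof (rule poly_eqI)
    fix k
    have "coeff (\<Sum>i\<le>degree g. monom (coeff g (p * i)) (p * i)) k
      = (\<Sum>i\<le>degree g. if p * i = k then coeff g k else 0)"
      by (auto simp: coeff_sum intro!: sum.cong)
    also have "\<dots> = coeff g k"
    proof (cases "coeff g k = 0")
      case False
      then obtain i where i: "k = p * i" using assms(2) by auto
      have "i \<le> k" using i assms(1) by simp
      also have "k \<le> degree g" using False by (rule le_degree)
      finally show ?thesis using assms(1) by (simp add: i)
    qed (auto intro: sum.neutral)
    finally show "coeff (\<Sum>i\<le>degree g. monom (coeff g (p * i)) (p * i)) k = coeff g k" .
  qed
  finally show ?thesis using that by metis
qed

text \<open>If x -> x^p is injective on the roots of \<open>g\<close>, then \<open>g\<close> has at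
  most as many roots as \<open>h\<close>, and the tower law gives equal degrees. Otherwise two roots
  differ by a p-th root of unity of K, and this symmetry makes \<open>g\<close> a polynomial in
  t^p.\<close>

lemma degree_factor_pcompose_prime_power:
  fixes a \<zeta> :: "'a::field_char_0"
  assumes p: "prime p" and \<zeta>: "\<zeta> ^ p = 1" "\<zeta> \<noteq> 1" and n: "n > 0" and a: "a \<noteq> 0"
    and h: "irreducible h" "h dvd monom 1 n - [:a:]"
    and g: "irreducible g" "g dvd pcompose h (monom 1 p)"
  shows "degree g = degree h \<or> degree g = p * degree h"
proof -
  have "p > 0" using p prime_gt_0_nat by blast
  have pos: "degree g > 0" "degree h > 0"
    using g h irreducible_field_poly_degree_pos by auto
  then have "g \<noteq> 0" "h \<noteq> 0" by auto
  have deg_hp: "degree (pcompose h (monom 1 p)) = degree h * p"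
    by (simp add: degree_monom_eq)
  have root_h: "x ^ p \<in> ac_roots h" if "x \<in> ac_roots g" for x
    using that ac_roots_dvd[OF g(2)] ac_roots_pcompose_monom by blast
  have root: "x ^ (p * n) = to_ac a" if "x \<in> ac_roots g" for x
    using ac_roots_dvd[OF h(2)] root_h[OF that] ac_roots_binomial by (metis power_mult subsetD)
  have tower: "degree h dvd degree g"
    using degree_dvd_degree_if_dvd_pcompose[OF h(1) g] .
  have "pcompose h (monom 1 p) dvd pcompose (monom 1 n - [:a:]) (monom 1 p)"
    using h(2) by (auto simp: dvd_def pcompose_mult)
  also have "\<dots> = monom 1 (p * n) - [:a:]"
    by (simp add: pcompose_diff monom_altdef pcompose_hom.hom_power pcompose_pCons power_mult)
  finally have "g dvd monom 1 (p * n) - [:a:]"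
    using g(2) dvd_trans by blast
  then have card: "card (ac_roots g) = degree g"
    using card_ac_roots_binomial_factor \<open>p > 0\<close> n a by (metis nat_0_less_mult_iff)
  show ?thesis
  proof (cases "inj_on (\<lambda>x. x ^ p) (ac_roots g)")
    case True
    have "degree g = card ((\<lambda>x. x ^ p) ` ac_roots g)"
      by (simp add: card_image[OF True] card)
    also have "\<dots> \<le> card (ac_roots h)"
      using root_h by (intro card_mono finite_ac_roots \<open>h \<noteq> 0\<close>) auto
    also have "\<dots> \<le> degree h"
      by (rule card_ac_roots_le[OF \<open>h \<noteq> 0\<close>])
    finally show ?thesis using dvd_imp_le[OF tower pos(1)] by simp
  next
    case False
    then obtain x y where xy: "x \<in> ac_roots g" "y \<in> ac_roots g" "x ^ p = y ^ p" "x \<noteq> y"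
      by (auto simp: inj_on_def)
    have "x \<noteq> 0" using root[OF xy(1)] a n \<open>p > 0\<close> by (auto simp: power_0_left)
    have "(y / x) ^ p = x ^ p / x ^ p"
      by (simp only: power_divide xy(3))
    then have "(y / x) ^ p = 1"
      using \<open>x \<noteq> 0\<close> by simp
    then obtain \<omega> where \<omega>: "y / x = to_ac \<omega>"
      by (rule root_of_unity_in_base_field[OF p \<zeta>])
    then have y: "y = to_ac \<omega> * x" using \<open>x \<noteq> 0\<close> by (simp add: field_simps)
    have "\<omega> \<noteq> 1" using y xy by auto
    have "to_ac (\<omega> ^ p) = to_ac 1"
      using \<open>(y / x) ^ p = 1\<close> by (simp add: \<omega>)
    then have \<omega>p: "\<omega> ^ p = 1" using to_ac_eq_iff by blast
    then have "\<omega> \<noteq> 0" using \<open>p > 0\<close> zero_power zero_neq_one by metis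
    \<comment> \<open>This is g(\<omega> t); it vanishes at \<open>x\<close> because
      \<open>g\<close> vanishes at \<open>y\<close>, so it is a scalar multiple of the irreducible
      \<open>g\<close>.\<close>
    define g' where "g' = pcompose g [:0, \<omega>:]"
    have "x \<in> ac_roots g'"
      using xy(2) by (simp add: g'_def ac_roots_pcompose hom_distribs y mult.commute)
    then have "g dvd g'"
      using irreducible_dvd_if_common_root[OF g(1) xy(1)] by blast
    moreover have "degree g' = degree g"
      using \<open>\<omega> \<noteq> 0\<close> by (simp add: g'_def)
    moreover from this have "g' \<noteq> 0" using pos(1) by auto
    ultimately obtain c where c: "g' = smult c g"
      using dvd_smult_if_dvd_same_degree by metis
    have coeff_g': "coeff g' i = \<omega> ^ i * coeff g i" for i
      by (simp add: g'_def coeff_pcompose_linear)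
    \<comment> \<open>The constant term is unchanged by t -> \<omega> t, so once nonzero it forces
      the scalar \<open>c\<close> to be 1.\<close>
    have "coeff g 0 \<noteq> 0"
    proof
      assume "coeff g 0 = 0"
      then have "0 \<in> ac_roots g" by (simp add: ac_roots_def poly_0_coeff_0)
      from root[OF this] show False using a n \<open>p > 0\<close> by (auto simp: power_0_left)
    qed
    then have "c = 1" using coeff_g'[of 0] c by simp
    \<comment> \<open>Comparing coefficients gives \<open>\<omega> ^ i = 1\<close>, and
      \<open>\<omega>\<close> has order \<open>p\<close>.\<close>
    have "p dvd i" if "coeff g i \<noteq> 0" for i
      using prime_dvd_if_power_eq_one[OF p \<omega>p \<open>\<omega> \<noteq> 1\<close>] coeff_g'[of i] c \<open>c = 1\<close> that by simp
    then obtain H where H: "g = pcompose H (monom 1 p)"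
      using poly_in_power_if_coeffs[OF \<open>p > 0\<close>] by blast
    have "H \<noteq> 0" using H \<open>g \<noteq> 0\<close> by auto
    \<comment> \<open>The common root of \<open>H\<close> and \<open>h\<close> bounds
      \<open>degree H\<close> from below; that \<open>g\<close> divides h(t^p) bounds it from
      above.\<close>
    have "x ^ p \<in> ac_roots H"
      using xy(1) H ac_roots_pcompose_monom by blast
    then have "h dvd H"
      using irreducible_dvd_if_common_root[OF h(1) root_h[OF xy(1)]] by blast
    then have "degree h \<le> degree H"
      using \<open>H \<noteq> 0\<close> by (rule dvd_imp_degree_le)
    have deg_g: "degree g = degree H * p"
      by (simp add: H degree_monom_eq)
    have "pcompose h (monom 1 p) \<noteq> 0"
      using deg_hp pos(2) \<open>p > 0\<close> by fastforce
    then have "degree H * p \<le> degree h * p"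
      using dvd_imp_degree_le[OF g(2)] deg_g deg_hp by metis
    then have "degree H \<le> degree h"
      using \<open>p > 0\<close> by (simp only: mult_le_cancel2)
    with \<open>degree h \<le> degree H\<close> have "degree H = degree h"
      by (rule le_antisym[rotated])
    then show ?thesis by (metis deg_g mult.commute)
  qed
qed

lemma degree_prime_power_binomial_factor:
  fixes a \<zeta> :: "'a::field_char_0"
  assumes p: "prime p" and \<zeta>: "\<zeta> ^ p = 1" "\<zeta> \<noteq> 1" and a: "a \<noteq> 0"
    and g: "irreducible g" "g dvd monom 1 (p ^ k) - [:a:]"
  shows "\<exists>s. degree g = p ^ s"
  using g
proof (induction k arbitrary: g)
  case 0
  have "degree g \<le> degree (monom 1 1 - [:a:])"
    using 0 binomial_nonzero[of 1 a] by (intro dvd_imp_degree_le) auto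
  then have "degree g = 1"
    using irreducible_field_poly_degree_pos[OF 0(1)] by (simp add: degree_binomial)
  then show ?case by (intro exI[of _ 0]) simp
next
  case (Suc k)
  have pk: "p ^ k > 0" using p prime_gt_0_nat by simp
  obtain x where x: "x \<in> ac_roots g"
    using ac_roots_nonempty irreducible_field_poly_degree_pos[OF Suc.prems(1)] by blast
  then have "x ^ p \<in> ac_roots (monom 1 (p ^ k) - [:a:])"
    using ac_roots_dvd[OF Suc.prems(2)] by (auto simp: ac_roots_binomial power_mult)
  then obtain h where h: "irreducible h" "h dvd monom 1 (p ^ k) - [:a:]" "x ^ p \<in> ac_roots h"
    using irreducible_factor_with_root binomial_nonzero[OF pk] by metis
  have "g dvd pcompose h (monom 1 p)"
    using irreducible_dvd_if_common_root[OF Suc.prems(1) x] h(3) ac_roots_pcompose_monom by blast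
  then have "degree g = degree h \<or> degree g = p * degree h"
    using degree_factor_pcompose_prime_power[OF p \<zeta> pk a h(1,2) Suc.prems(1)] by blast
  then show ?case using Suc.IH[OF h(1,2)] by (metis power_Suc)
qed

section \<open>Degrees dividing all others\<close>

text \<open>Divisibility replaces minimality here: such a \<open>d\<close> is at once the least
  degree, and divisibility statements combine over coprime exponents.\<close>

definition exact_degree :: "'a::field \<Rightarrow> nat \<Rightarrow> nat \<Rightarrow> bool" where
  "exact_degree a n d \<longleftrightarrow>
     (\<exists>g. irreducible g \<and> g dvd monom 1 n - [:a:] \<and> degree g = d) \<and>
     (\<forall>g. irreducible g \<longrightarrow> g dvd monom 1 n - [:a:] \<longrightarrow> d dvd degree g)"

lemma lambdaK_eq_if_exact_degree: "exact_degree a n d \<Longrightarrow> lambdaK a n = d"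
  unfolding lambdaK_def exact_degree_def
  by (intro Least_equality) (auto intro!: dvd_imp_le irreducible_field_poly_degree_pos)

lemma ex_irreducible_binomial_factor:
  fixes a :: "'a::field"
  assumes "n > 0"
  obtains g where "irreducible g" "g dvd monom 1 n - [:a:]"
proof -
  obtain x where "x \<in> ac_roots (monom 1 n - [:a:])"
    using ac_roots_nonempty degree_binomial assms by metis
  then show ?thesis
    using irreducible_factor_with_root[OF binomial_nonzero[OF assms]] that by metis
qed

text \<open>All degrees are powers of \<open>p\<close>, and among these the order by size is the
  order by divisibility.\<close>

lemma ex_exact_degree_if_root_of_unity:
  fixes a \<zeta> :: "'a::field_char_0"
  assumes p: "prime p" and \<zeta>: "\<zeta> ^ p = 1" "\<zeta> \<noteq> 1" and a: "a \<noteq> 0"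
  shows "\<exists>s. exact_degree a (p ^ k) (p ^ s)"
proof -
  have "p ^ k > 0" "p > 1" using prime_gt_0_nat[OF p] prime_gt_1_nat[OF p] by auto
  let ?P = "\<lambda>g. irreducible g \<and> g dvd monom 1 (p ^ k) - [:a:]"
  obtain g0 where "?P g0"
    using ex_irreducible_binomial_factor[OF \<open>p ^ k > 0\<close>] by blast
  then obtain g where g: "?P g" and min: "\<And>h. ?P h \<Longrightarrow> degree g \<le> degree h"
    using ex_has_least_nat[of ?P g0 degree] by blast
  obtain s where s: "degree g = p ^ s"
    using degree_prime_power_binomial_factor[OF p \<zeta> a] g by blast
  have "p ^ s dvd degree h" if h: "?P h" for h
  proof -
    obtain s' where s': "degree h = p ^ s'"
      using degree_prime_power_binomial_factor[OF p \<zeta> a] h by blast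
    have "s \<le> s'" using min[OF h] \<open>p > 1\<close> by (simp add: s s')
    then show ?thesis by (simp add: s' le_imp_power_dvd)
  qed
  then show ?thesis using g s unfolding exact_degree_def by blast
qed

section \<open>Prime power exponents, without a nontrivial root of unity in K\<close>

lemma eq_if_prime_power_eq:
  fixes x y :: "'a::field"
  assumes "\<And>z :: 'a. z ^ p = 1 \<Longrightarrow> z = 1" "x ^ (p ^ j) = y ^ (p ^ j)" "y \<noteq> 0"
  shows "x = y"
  using assms(2,3)
proof (induction j arbitrary: x y)
  case (Suc j)
  have "(x ^ p) ^ (p ^ j) = (y ^ p) ^ (p ^ j)"
    using Suc.prems(1) by (simp add: power_mult)
  then have "x ^ p = y ^ p"
    by (rule Suc.IH) (use Suc.prems(2) in simp)
  then have "(x / y) ^ p = y ^ p / y ^ p" by (simp only: power_divide)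
  then have "(x / y) ^ p = 1" using Suc.prems(2) by simp
  then have "x / y = 1" by (rule assms(1))
  then show ?case using Suc.prems(2) by simp
qed simp

text \<open>With Bezout coefficients m x = p y + 1, the root is c^x / b^y.\<close>

lemma is_power_if_coprime_power_is_power:
  fixes b c :: "'a::field"
  assumes "c ^ p = b ^ m" "coprime m p" "b \<noteq> 0" "m \<noteq> 0"
  obtains d where "b = d ^ p"
proof -
  obtain x y where xy: "m * x = p * y + 1"
    using bezout_nat[of m p] assms by auto
  have "(c ^ x) ^ p = (b ^ m) ^ x"
    by (metis assms(1) mult.commute power_mult)
  also have "\<dots> = (b ^ y) ^ p * b"
    by (metis xy mult.commute power_add power_mult power_one_right)
  finally have "b = (c ^ x / b ^ y) ^ p"
    using assms(3) by (simp add: power_divide field_simps)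
  then show ?thesis by (rule that)
qed

lemma ex_exact_degree_if_no_root_of_unity:
  fixes a :: "'a::field"
  assumes p: "prime p" and inj: "\<And>z :: 'a. z ^ p = 1 \<Longrightarrow> z = 1" and a: "a \<noteq> 0"
  shows "\<exists>s. exact_degree a (p ^ k) (p ^ s)"
proof -
  have "p > 0" using p prime_gt_0_nat by blast
  \<comment> \<open>The bound \<open>j \<le> k\<close> guarantees a greatest \<open>j\<close>, even
    if \<open>a\<close> is a p^j-th power for every j.\<close>
  let ?P = "\<lambda>j. j \<le> k \<and> (\<exists>b. a = b ^ (p ^ j))"
  have "?P 0" by simp
  then obtain j where j: "?P j" and max: "\<And>i. ?P i \<Longrightarrow> i \<le> j"
    using GreatestI_nat[of ?P 0 k] Greatest_le_nat[of ?P _ k] by blast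
  then obtain b where b: "a = b ^ (p ^ j)" by blast
  define r where "r = k - j"
  have k: "k = r + j" using j by (simp add: r_def)
  have "b \<noteq> 0" using a b \<open>p > 0\<close> by (auto simp: power_0_left)
  have dvd: "p ^ r dvd degree g" if g: "irreducible g" "g dvd monom 1 (p ^ k) - [:a:]" for g
  proof (rule ccontr)
    assume ndvd: "\<not> p ^ r dvd degree g"
    define e where "e = multiplicity p (degree g)"
    have "degree g \<noteq> 0" using irreducible_field_poly_degree_pos[OF g(1)] by simp
    moreover have "\<not> is_unit p" using p not_prime_unit by blast
    ultimately obtain m where m: "degree g = p ^ e * m" "\<not> p dvd m"
      using multiplicity_decompose' unfolding e_def by metis
    have "e < r" using ndvd m(1) le_imp_power_dvd[of r e p] by (metis dvd_mult2 not_le)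
    then obtain i where r: "r = Suc i + e"
      by (metis add.commute add_Suc_right less_imp_Suc_add)
    obtain c where "c ^ (p ^ k) = a ^ degree g"
      using power_constant_term_binomial_factor[OF _ g(2)] \<open>p > 0\<close> by auto
    \<comment> \<open>Here k = i + 1 + e + j and \<open>a ^ degree g\<close> is b^(p^(e + j) m).
      Unique extraction of p-th roots cancels the common exponent p^(e + j).\<close>
    then have "((c ^ (p ^ i)) ^ p) ^ (p ^ (e + j)) = (b ^ m) ^ (p ^ (e + j))"
      by (simp add: b k r m(1) power_add flip: power_mult) (simp add: ac_simps)
    then have "(c ^ (p ^ i)) ^ p = b ^ m"
      using eq_if_prime_power_eq[OF inj] \<open>b \<noteq> 0\<close> by (metis power_not_zero)
    moreover have "coprime m p"
      using m(2) p prime_imp_coprime coprime_commute by blast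
    moreover have "m \<noteq> 0" using m(2) dvd_0_right by metis
    ultimately obtain d where "b = d ^ p"
      using is_power_if_coprime_power_is_power \<open>b \<noteq> 0\<close> by metis
    \<comment> \<open>A p-th root of \<open>b\<close> contradicts the maximality of
      \<open>j\<close>; \<open>e < r\<close> leaves room for \<open>Suc j \<le> k\<close>.\<close>
    then have "a = d ^ (p ^ Suc j)"
      by (simp add: b power_mult)
    moreover have "Suc j \<le> k" using \<open>e < r\<close> k by simp
    ultimately have "Suc j \<le> j" by (intro max) blast
    then show False by simp
  qed
  have pr: "p ^ r > 0" using \<open>p > 0\<close> by simp
  \<comment> \<open>Every root of t^(p^r) - b is a root of t^(p^k) - a, so this \<open>g\<close> has
    degree at most \<open>p ^ r\<close> and divisible by \<open>p ^ r\<close>.\<close>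
  obtain g where g: "irreducible g" "g dvd monom 1 (p ^ r) - [:b:]"
    using ex_irreducible_binomial_factor[OF pr] by blast
  then obtain x where x: "x \<in> ac_roots g"
    using ac_roots_nonempty irreducible_field_poly_degree_pos by blast
  then have "x ^ (p ^ r) = to_ac b"
    using ac_roots_dvd[OF g(2)] ac_roots_binomial by blast
  then have "x ^ (p ^ k) = to_ac a"
    by (simp add: k b power_add power_mult)
  then have "g dvd monom 1 (p ^ k) - [:a:]"
    using irreducible_dvd_if_common_root[OF g(1) x] ac_roots_binomial by blast
  moreover have "degree g \<le> p ^ r"
    using dvd_imp_degree_le[OF g(2) binomial_nonzero[OF pr]] by (simp add: degree_binomial[OF pr])
  ultimately have "degree g = p ^ r" "g dvd monom 1 (p ^ k) - [:a:]"
    using dvd[OF g(1)] irreducible_field_poly_degree_pos[OF g(1)]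
    by (auto simp: dvd_imp_le le_antisym)
  then show ?thesis using g(1) dvd unfolding exact_degree_def by blast
qed

section \<open>Coprime exponents\<close>

lemma exact_degree_dvd_factor_mult:
  fixes a :: "'a::field"
  assumes d: "exact_degree a m d" and m: "m > 0" and g: "irreducible g" "g dvd monom 1 (m * n) - [:a:]"
  shows "d dvd degree g"
proof -
  obtain x where x: "x \<in> ac_roots g"
    using ac_roots_nonempty irreducible_field_poly_degree_pos[OF g(1)] by blast
  \<comment> \<open>The n-th power of a root is a root of t^m - a; the tower law compares the
    degrees of the two irreducible factors.\<close>
  then have "x ^ n \<in> ac_roots (monom 1 m - [:a:])"
    using ac_roots_dvd[OF g(2)] by (auto simp: ac_roots_binomial mult.commute simp flip: power_mult)
  then obtain h where h: "irreducible h" "h dvd monom 1 m - [:a:]" "x ^ n \<in> ac_roots h"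
    using irreducible_factor_with_root binomial_nonzero[OF m] by metis
  then have "g dvd pcompose h (monom 1 n)"
    using irreducible_dvd_if_common_root[OF g(1) x] ac_roots_pcompose_monom by blast
  then have "degree h dvd degree g"
    by (rule degree_dvd_degree_if_dvd_pcompose[OF h(1) g(1)])
  moreover have "d dvd degree h"
    using d h unfolding exact_degree_def by blast
  ultimately show ?thesis by (rule dvd_trans[rotated])
qed

text \<open>Both \<open>d\<close> and \<open>e\<close> divide every degree, hence so does
  \<open>d * e\<close>. A factor with a root \<theta> glued from roots \<open>x\<close> and
  \<open>y\<close> of factors of degrees \<open>d\<close> and \<open>e\<close> attains it, by
  counting pairs.\<close>

lemma exact_degree_mult:
  fixes a :: "'a::field_char_0"
  assumes a: "a \<noteq> 0" and mn: "m > 0" "n > 0" "coprime m n"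
    and d: "exact_degree a m d" and e: "exact_degree a n e" and de: "coprime d e"
  shows "exact_degree a (m * n) (d * e)"
proof -
  have "m * n > 0" using mn by simp
  have dvd: "d * e dvd degree g" if "irreducible g" "g dvd monom 1 (m * n) - [:a:]" for g
  proof (rule divides_mult[OF _ _ de])
    show "d dvd degree g"
      using exact_degree_dvd_factor_mult[OF d mn(1) that] .
    show "e dvd degree g"
      using exact_degree_dvd_factor_mult[OF e mn(2) that(1)] that(2) by (simp add: mult.commute)
  qed
  obtain h1 where h1: "irreducible h1" "h1 dvd monom 1 m - [:a:]" "degree h1 = d"
    using d unfolding exact_degree_def by blast
  obtain h2 where h2: "irreducible h2" "h2 dvd monom 1 n - [:a:]" "degree h2 = e"
    using e unfolding exact_degree_def by blast
  have nz: "h1 \<noteq> 0" "h2 \<noteq> 0"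
    using h1(1) h2(1) irreducible_field_poly_degree_pos by fastforce+
  obtain x where x: "x \<in> ac_roots h1"
    using ac_roots_nonempty irreducible_field_poly_degree_pos[OF h1(1)] by blast
  obtain y where y: "y \<in> ac_roots h2"
    using ac_roots_nonempty irreducible_field_poly_degree_pos[OF h2(1)] by blast
  have xm: "x ^ m = to_ac a" and yn: "y ^ n = to_ac a"
    using x y ac_roots_dvd[OF h1(2)] ac_roots_dvd[OF h2(2)] ac_roots_binomial by blast+
  have "x \<noteq> 0" "y \<noteq> 0" using xm yn a mn by (auto simp: power_0_left)
  obtain u v where uv: "u * int n + v * int m = 1"
    using bezout_int[of "int n" "int m"] mn(3) by (auto simp: coprime_commute)
  have powi: "(t ^ k) powi w = t powi (w * int k)" for t :: "'a alg_closure" and k w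
    by (metis mult.commute power_int_mult power_int_of_nat)
  \<comment> \<open>The inverse of t -> (t^n, t^m) on nonzero roots; Bezout exponents may be
    negative, hence \<open>powi\<close>.\<close>
  define \<Phi> :: "'a alg_closure \<times> 'a alg_closure \<Rightarrow> 'a alg_closure"
    where "\<Phi> = (\<lambda>(x, y). x powi u * y powi v)"
  have \<Phi>_pow: "\<Phi> (t ^ n, t ^ m) = t" if "t \<noteq> 0" for t
  proof -
    have "\<Phi> (t ^ n, t ^ m) = t powi (u * int n) * t powi (v * int m)"
      by (simp add: \<Phi>_def powi)
    also have "\<dots> = t powi (u * int n + v * int m)"
      using that by (simp add: power_int_add)
    finally show ?thesis by (simp add: uv)
  qed
  define \<theta> where "\<theta> = \<Phi> (x, y)"
  have \<theta>_pow: "\<theta> ^ k = x powi (u * int k) * y powi (v * int k)" for k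
    by (simp add: \<theta>_def \<Phi>_def power_mult_distrib power_int_power')
  \<comment> \<open>The factor in \<open>y\<close> becomes a power of \<open>x\<close> because y^n =
    a = x^m; the exponents then add up to 1.\<close>
  have "\<theta> ^ n = x powi (u * int n) * (y ^ n) powi v"
    by (simp only: \<theta>_pow powi)
  also have "(y ^ n) powi v = x powi (v * int m)"
    by (simp only: yn xm[symmetric] powi)
  also have "x powi (u * int n) * x powi (v * int m) = x"
    using \<open>x \<noteq> 0\<close> uv by (simp flip: power_int_add)
  finally have \<theta>n: "\<theta> ^ n = x" .
  have "\<theta> ^ m = (x ^ m) powi u * y powi (v * int m)"
    by (simp only: \<theta>_pow powi)
  also have "(x ^ m) powi u = y powi (u * int n)"
    by (simp only: xm yn[symmetric] powi)
  also have "y powi (u * int n) * y powi (v * int m) = y"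
    using \<open>y \<noteq> 0\<close> uv by (simp flip: power_int_add)
  finally have \<theta>m: "\<theta> ^ m = y" .
  have "\<theta> \<in> ac_roots (monom 1 (m * n) - [:a:])"
    using \<theta>n xm ac_roots_binomial by (metis mult.commute power_mult)
  then obtain g where g: "irreducible g" "g dvd monom 1 (m * n) - [:a:]" "\<theta> \<in> ac_roots g"
    using irreducible_factor_with_root binomial_nonzero[OF \<open>m * n > 0\<close>] by metis
  have g1: "g dvd pcompose h1 (monom 1 n)" and g2: "g dvd pcompose h2 (monom 1 m)"
    using irreducible_dvd_if_common_root[OF g(1,3)] ac_roots_pcompose_monom \<theta>n \<theta>m x y by metis+
  have sub: "ac_roots g \<subseteq> \<Phi> ` (ac_roots h1 \<times> ac_roots h2)"
  proof
    fix t assume t: "t \<in> ac_roots g"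
    then have "t ^ (m * n) = to_ac a"
      using ac_roots_dvd[OF g(2)] ac_roots_binomial by blast
    then have "t \<noteq> 0" using a \<open>m * n > 0\<close> by (auto simp: power_0_left)
    moreover have "t ^ n \<in> ac_roots h1" "t ^ m \<in> ac_roots h2"
      using t ac_roots_dvd[OF g1] ac_roots_dvd[OF g2] ac_roots_pcompose_monom by blast+
    ultimately show "t \<in> \<Phi> ` (ac_roots h1 \<times> ac_roots h2)"
      using \<Phi>_pow by (metis SigmaI imageI)
  qed
  have fin: "finite (ac_roots h1 \<times> ac_roots h2)"
    using finite_ac_roots nz by blast
  \<comment> \<open>Simplicity of the roots turns the bound on their number into one on the
    degree.\<close>
  have "degree g = card (ac_roots g)"
    using card_ac_roots_binomial_factor[OF \<open>m * n > 0\<close> a g(2)] by simp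
  also have "\<dots> \<le> card (ac_roots h1 \<times> ac_roots h2)"
    using surj_card_le[OF fin sub] .
  also have "\<dots> \<le> d * e"
    using card_ac_roots_le nz h1(3) h2(3) by (metis card_cartesian_product mult_le_mono)
  finally have "degree g = d * e"
    using dvd_imp_le[OF dvd[OF g(1,2)] irreducible_field_poly_degree_pos[OF g(1)]]
    by (rule le_antisym)
  then show ?thesis using g dvd unfolding exact_degree_def by blast
qed

section \<open>Arbitrary exponents\<close>

text \<open>The induction splits off the full p-part of \<open>n\<close>. The clause on prime
  divisors supplies the coprimality of degrees that the product step requires.\<close>

lemma ex_exact_degree:
  fixes a :: "'a::field_char_0"
  assumes a: "a \<noteq> 0" and "n > 0"
  shows "\<exists>d. exact_degree a n d \<and> (\<forall>q. prime q \<longrightarrow> q dvd d \<longrightarrow> q dvd n)"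
  using \<open>n > 0\<close>
proof (induction n rule: less_induct)
  case (less n)
  have prime_power: "\<exists>s. exact_degree a (p ^ k) (p ^ s)" if "prime p" for p k
    using ex_exact_degree_if_root_of_unity[OF that _ _ a]
      ex_exact_degree_if_no_root_of_unity[OF that _ a] by blast
  show ?case
  proof (cases "n = 1")
    case True
    obtain g :: "'a poly" where g: "irreducible g" "g dvd monom 1 n - [:a:]"
      using ex_irreducible_binomial_factor[OF less.prems] by blast
    have "degree g \<le> 1"
      using dvd_imp_degree_le[OF g(2) binomial_nonzero[OF less.prems]]
        degree_binomial[OF less.prems, of a] True by simp
    then have "degree g = 1"
      using irreducible_field_poly_degree_pos[OF g(1)] by simp
    then have "exact_degree a n 1"
      using g unfolding exact_degree_def by auto
    then show ?thesis by (intro exI[of _ 1]) auto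
  next
    case False
    then obtain p where p: "prime p" "p dvd n"
      using prime_factor_nat by blast
    define k where "k = multiplicity p n"
    have "n \<noteq> 0" "\<not> is_unit p" using less.prems p(1) not_prime_unit by auto
    then obtain n' where n': "n = p ^ k * n'" "\<not> p dvd n'"
      using multiplicity_decompose' unfolding k_def by metis
    have "k > 0"
      using p less.prems by (simp add: k_def prime_multiplicity_gt_zero_iff)
    then have "1 < p ^ k"
      by (rule one_less_power[OF prime_gt_1_nat[OF p(1)]])
    have "n' > 0" using n'(2) by (auto intro: gr0I)
    then have "n' < n" using \<open>1 < p ^ k\<close> by (simp add: n'(1))
    then obtain d where d: "exact_degree a n' d" "\<And>q. prime q \<Longrightarrow> q dvd d \<Longrightarrow> q dvd n'"
      using less.IH \<open>n' > 0\<close> by blast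
    obtain s where s: "exact_degree a (p ^ k) (p ^ s)"
      using prime_power p by blast
    have "coprime (p ^ k) n'"
      using n'(2) p by (simp add: prime_imp_coprime)
    moreover have "coprime (p ^ s) d"
      using n'(2) d(2) p by (metis coprime_power_left_iff prime_imp_coprime)
    moreover have "p ^ k > 0" using \<open>1 < p ^ k\<close> by linarith
    ultimately have "exact_degree a (p ^ k * n') (p ^ s * d)"
      using exact_degree_mult[OF a _ \<open>n' > 0\<close> _ s d(1)] by blast
    then have "exact_degree a n (p ^ s * d)"
      by (simp only: n'(1)[symmetric])
    moreover have "q dvd n" if "prime q" "q dvd p ^ s * d" for q
    proof -
      have "q dvd p ^ s \<or> q dvd d"
        using that by (simp add: prime_dvd_mult_iff)
      then show ?thesis
      proof
        assume "q dvd p ^ s"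
        then have "q dvd p" using that(1) prime_dvd_power by blast
        then show ?thesis using p(2) dvd_trans by blast
      next
        assume "q dvd d"
        then have "q dvd n'" using d(2) that(1) by blast
        then show ?thesis using n'(1) dvd_mult by blast
      qed
    qed
    ultimately show ?thesis by (intro exI[of _ "p ^ s * d"] conjI allI impI)
  qed
qed

theorem theorem1p3:
  fixes \<alpha> :: "'a::field_char_0" and n :: nat and f :: "'a poly"
  assumes "n > 0"
    and "f dvd (monom 1 n - [:\<alpha>:])"
  shows "lambdaK \<alpha> n dvd degree f"
proof -
  obtain d where d: "exact_degree \<alpha> n d"
  proof (cases "\<alpha> = 0")
    case True
    \<comment> \<open>For \<alpha> = 0 the factor t has degree 1, which divides everything.\<close>
    have "irreducible ([:0, 1:] :: 'a poly)"
      by (rule irreducible_linear_field_poly) simp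
    moreover have "([:0, 1:] :: 'a poly) dvd monom 1 n - [:\<alpha>:]"
      using \<open>n > 0\<close> True poly_eq_0_iff_dvd[of "monom 1 n - [:\<alpha>:]" 0]
      by (simp add: poly_monom power_0_left)
    moreover have "degree ([:0, 1:] :: 'a poly) = 1"
      by simp
    ultimately have "exact_degree \<alpha> n 1"
      unfolding exact_degree_def by (metis one_dvd)
    then show ?thesis by (rule that)
  next
    case False
    then show ?thesis using ex_exact_degree \<open>n > 0\<close> that by blast
  qed
  have "f \<noteq> 0"
    using assms(2) binomial_nonzero[OF assms(1)] dvd_0_left by metis
  moreover have "d dvd degree g" if "irreducible g" "g dvd f" for g
    using d that(1) dvd_trans[OF that(2) assms(2)] unfolding exact_degree_def by blast
  ultimately have "d dvd degree f"
    by (rule dvd_degree_if_dvd_irreducible_factors)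
  then show ?thesis by (simp only: lambdaK_eq_if_exact_degree[OF d])
qed

end
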